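(* Let $\Sigma$ be a finite alphabet and let $f:\Sigma^{\mathbb{Z}}\to\Sigma^{\mathbb{Z}}$ be a CA-like function. Then $f$ is a cellular automaton (as a map on the Besicovitch space), i.e. there exists a single cellular automaton $g:\Sigma^{\mathbb{Z}}\to\Sigma^{\mathbb{Z}}$ such that $f(x)\sim_B g(x)$ for all $x\in\Sigma^{\mathbb{Z}}$.
   Context: On $\Sigma^{\mathbb{Z}}$ let $d_B(x,y)=\limsup_{n\to\infty}\frac{1}{2n+1}|\{i\in[-n,n] : x_i\ne y_i\}|$ (the Besicovitch pseudometric), and write $x\sim_B y$ if $d_B(x,y)=0$. A cellular automaton on $\Sigma^{\mathbb{Z}}$ is a map that is continuous in the product topology and commutes with the shift $\sigma(x)_i=x_{i+1}$. A map $f:\Sigma^{\mathbb{Z}}\to\Sigma^{\mathbb{Z}}$ is CA-like if it is continuous with respect to $d_B$, commutes with the shift up to $\sim_B$ (i.e. $f(\sigma(x))\sim_B\sigma(f(x))$ for all $x$), and for each $x\in\Sigma^{\mathbb{Z}}$ there exists a cellular automaton $g_x$ on $\Sigma^{\mathbb{Z}}$ such that $f(x)\sim_B g_x(x)$. *)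

theory Defs
  imports "HOL-Analysis.Analysis"
begin

type_synonym 'a config = "int \<Rightarrow> 'a"

definition shift :: "'a config \<Rightarrow> 'a config" where
  "shift x = (\<lambda>i. x (i + 1))"

(* Extended reals are used because limsup needs a complete lattice; the values lie in [0,1]. *)
definition besicovitch_dist :: "'a config \<Rightarrow> 'a config \<Rightarrow> ereal" where
  "besicovitch_dist x y =
     limsup (\<lambda>n::nat. ereal (real (card {i \<in> {- int n..int n}. x i \<noteq> y i}) / real (2 * n + 1)))"

definition besicovitch_equiv :: "'a config \<Rightarrow> 'a config \<Rightarrow> bool" (infix "\<sim>\<^sub>B" 50) where
  "x \<sim>\<^sub>B y \<longleftrightarrow> besicovitch_dist x y = 0"

definition config_topology :: "'a config topology" where
  "config_topology = product_topology (\<lambda>_. discrete_topology UNIV) UNIV"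

definition cellular_automaton :: "('a config \<Rightarrow> 'a config) \<Rightarrow> bool" where
  "cellular_automaton g \<longleftrightarrow>
     continuous_map config_topology config_topology g \<and> (\<forall>x. g (shift x) = shift (g x))"

definition besicovitch_continuous :: "('a config \<Rightarrow> 'a config) \<Rightarrow> bool" where
  "besicovitch_continuous f \<longleftrightarrow>
     (\<forall>x. \<forall>\<epsilon>::real. \<epsilon> > 0 \<longrightarrow> (\<exists>\<delta>::real. \<delta> > 0 \<and>
        (\<forall>y. besicovitch_dist x y < ereal \<delta> \<longrightarrow> besicovitch_dist (f x) (f y) < ereal \<epsilon>)))"

definition CA_like :: "('a config \<Rightarrow> 'a config) \<Rightarrow> bool" where
  "CA_like f \<longleftrightarrow>
     besicovitch_continuous f \<and>
     (\<forall>x. f (shift x) \<sim>\<^sub>B shift (f x)) \<and>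
     (\<forall>x. \<exists>g. cellular_automaton g \<and> f x \<sim>\<^sub>B g x)"

end

theory Submission
  imports Defs "HOL-Library.Discrete_Functions" "HOL-Real_Asymp.Real_Asymp"
begin

text \<open>
  Join an arbitrary configuration \<open>y\<close> (time 0) to a fixed generic one (time 1) by a Besicovitch-continuous
  path \<open>z\<close> such that at every time \<open>t > 0\<close> each finite word occurs in \<open>z t\<close> with positive upper density.
  For \<open>t > 0\<close> two different cellular automata then disagree on \<open>z t\<close>. As there are only countably many
  cellular automata, the sets of times \<open>t\<close> with \<open>f (z t) \<sim>\<^sub>B g (z t)\<close> partition each interval \<open>[a, 1]\<close>,
  \<open>a > 0\<close>, into countably many closed sets, so by Sierpinski's theorem a single automaton works along
  the whole path, and by continuity also at time 0. It is the one attached to the generic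
  configuration, hence independent of \<open>y\<close>.
\<close>

section \<open>The Besicovitch pseudometric through frequencies\<close>

definition diff_freq :: "'a config \<Rightarrow> 'a config \<Rightarrow> nat \<Rightarrow> real" where
  "diff_freq x y n = real (card {i \<in> {- int n..int n}. x i \<noteq> y i}) / real (2 * n + 1)"

text \<open>Lies between \<open>besicovitch_dist x y < e\<close> and
  \<open>besicovitch_dist x y \<le> e\<close>. Eventual bounds replace the limsup, so estimates stay
  in the reals.\<close>

definition close :: "real \<Rightarrow> 'a config \<Rightarrow> 'a config \<Rightarrow> bool" where
  "close e x y \<longleftrightarrow> eventually (\<lambda>n. diff_freq x y n < e) sequentially"

lemma close_if_dist_less: "besicovitch_dist x y < ereal e \<Longrightarrow> close e x y"
  unfolding besicovitch_dist_def close_def diff_freq_def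
  by (drule Limsup_lessD) simp

lemma dist_le_if_close:
  assumes "close e x y"
  shows "besicovitch_dist x y \<le> ereal e"
  unfolding besicovitch_dist_def
  by (rule Limsup_bounded, rule eventually_mono[OF assms[unfolded close_def diff_freq_def]]) simp

lemma dist_nonneg: "besicovitch_dist x y \<ge> 0"
  unfolding besicovitch_dist_def by (rule le_Limsup) auto

lemma equiv_iff_close: "x \<sim>\<^sub>B y \<longleftrightarrow> (\<forall>e>0. close e x y)"
proof
  assume "x \<sim>\<^sub>B y"
  then show "\<forall>e>0. close e x y"
    by (auto simp: besicovitch_equiv_def intro!: close_if_dist_less)
next
  assume *: "\<forall>e>0. close e x y"
  have "besicovitch_dist x y \<le> 0"
  proof (rule ereal_le_epsilon2)
    fix e :: real assume "e > 0"
    then show "besicovitch_dist x y \<le> 0 + ereal e"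
      using * dist_le_if_close[of e x y] by simp
  qed
  then show "x \<sim>\<^sub>B y"
    using dist_nonneg[of x y] by (simp add: besicovitch_equiv_def)
qed

lemma close_sym: "close e x y \<longleftrightarrow> close e y x"
proof -
  have "diff_freq x y = diff_freq y x"
    unfolding diff_freq_def by (intro ext) metis
  then show ?thesis by (simp add: close_def)
qed

lemma finite_window: "finite {i \<in> {- int n..int n}. P i}"
  by (rule finite_subset[of _ "{- int n..int n}"]) auto

lemma diff_freq_triangle: "diff_freq x z n \<le> diff_freq x y n + diff_freq y z n"
proof -
  let ?D = "\<lambda>x y :: 'a config. {i \<in> {- int n..int n}. x i \<noteq> y i}"
  have "card (?D x z) \<le> card (?D x y \<union> ?D y z)"
    by (intro card_mono finite_UnI finite_window) auto
  also have "\<dots> \<le> card (?D x y) + card (?D y z)"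
    by (rule card_Un_le)
  finally show ?thesis
    unfolding diff_freq_def add_divide_distrib[symmetric]
    by (intro divide_right_mono) simp_all
qed

lemma close_triangle:
  assumes "close a x y" "close b y z"
  shows "close (a + b) x z"
  using assms unfolding close_def
  by eventually_elim (rule le_less_trans[OF diff_freq_triangle[of x z _ y] add_strict_mono])

lemma besicovitch_continuous_close:
  assumes "besicovitch_continuous f" "e > 0"
  obtains d where "d > 0" "\<And>y. close d x y \<Longrightarrow> close e (f x) (f y)"
proof -
  obtain d :: real where d: "d > 0"
    "\<And>y. besicovitch_dist x y < ereal d \<Longrightarrow> besicovitch_dist (f x) (f y) < ereal e"
    using assms unfolding besicovitch_continuous_def by blast
  show thesis
  \<comment> \<open>\<open>close (d/2)\<close> gives only a weak bound on the distance; halving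
    makes it strictly less than \<open>d\<close>.\<close>
  proof (rule that[of "d/2"])
    show "close e (f x) (f y)" if "close (d/2) x y" for y
      using dist_le_if_close[OF that] d by (intro close_if_dist_less d(2)) (auto elim: le_less_trans)
  qed (use d in simp)
qed

section \<open>Cellular automata\<close>

definition translate :: "int \<Rightarrow> 'a config \<Rightarrow> 'a config" where
  "translate k x = (\<lambda>i. x (i + k))"

text \<open>Constrains the output at cell 0 only; for a cellular automaton, commutation with
  translations carries this to every cell.\<close>

definition has_radius :: "nat \<Rightarrow> ('a config \<Rightarrow> 'a config) \<Rightarrow> bool" where
  "has_radius r g \<longleftrightarrow> (\<forall>x y. (\<forall>j. \<bar>j\<bar> \<le> int r \<longrightarrow> x j = y j) \<longrightarrow> g x 0 = g y 0)"

lemma has_radius_mono: "has_radius r g \<Longrightarrow> r \<le> s \<Longrightarrow> has_radius s g"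
  unfolding has_radius_def by (meson of_nat_mono order_trans)

lemma cellular_automaton_translate:
  assumes "cellular_automaton g"
  shows "g (translate k x) = translate k (g x)"
proof -
  have nat: "g (translate (int n) x) = translate (int n) (g x)" for n x
  proof (induction n)
    case 0
    then show ?case by (simp add: translate_def)
  next
    case (Suc n)
    have "translate (int (Suc n)) x = shift (translate (int n) x)" for x :: "'a config"
      by (simp add: translate_def shift_def add_ac)
    then show ?case
      using Suc assms by (simp add: cellular_automaton_def)
  qed
  show ?thesis
  proof (cases "k \<ge> 0")
    case True
    then show ?thesis using nat[of "nat k"] by simp
  next
    case False
    have "g x = g (translate (int (nat (- k))) (translate k x))"
      using False by (simp add: translate_def)
    also have "\<dots> = translate (- k) (g (translate k x))"
      using nat[of "nat (- k)"] False by simp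
    finally show ?thesis by (simp add: translate_def)
  qed
qed

lemma cellular_automaton_eq_local:
  assumes "cellular_automaton g" "has_radius r g"
    and "\<And>j. \<bar>j\<bar> \<le> int r \<Longrightarrow> x (i + j) = u j"
  shows "g x i = g u 0"
proof -
  have "g x i = g (translate i x) 0"
    using assms(1) by (simp add: cellular_automaton_translate) (simp add: translate_def)
  also have "\<dots> = g u 0"
    using assms(2,3) unfolding has_radius_def by (auto simp: translate_def add.commute)
  finally show ?thesis .
qed

text \<open>Locality in the Curtis-Hedlund-Lyndon theorem. Around each configuration the output at 0
  is constant on some cylinder; by compactness finitely many of these cylinders cover the space, and
  their largest radius works everywhere.\<close>

lemma cellular_automaton_has_radius:
  fixes g :: "('a::finite) config \<Rightarrow> 'a config"
  assumes "cellular_automaton g"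
  obtains r where "has_radius r g"
proof -
  let ?T = "config_topology :: 'a config topology"
  have tops: "topspace ?T = UNIV"
    by (simp add: config_topology_def PiE_UNIV_domain)
  have comp: "compact_space ?T"
    unfolding config_topology_def compact_space_product_topology
    by (simp add: compact_space_discrete_topology)
  define cyl where "cyl x r = {y. \<forall>j. \<bar>j\<bar> \<le> int r \<longrightarrow> y j = x j}" for x :: "'a config" and r
  have cyl_open: "openin ?T (cyl x r)" for x r
    unfolding config_topology_def openin_product_topology_alt
  proof
    fix z assume z: "z \<in> cyl x r"
    let ?U = "\<lambda>i. if \<bar>i\<bar> \<le> int r then {x i} else UNIV"
    have "{i. ?U i \<noteq> UNIV} \<subseteq> {- int r..int r}" by (auto split: if_splits)
    then have "finite {i. ?U i \<noteq> UNIV}" by (rule finite_subset) simp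
    then show "\<exists>U. finite {i \<in> UNIV. U i \<noteq> topspace (discrete_topology (UNIV::'a set))} \<and>
        (\<forall>i\<in>UNIV. openin (discrete_topology (UNIV::'a set)) (U i)) \<and>
        z \<in> Pi\<^sub>E UNIV U \<and> Pi\<^sub>E UNIV U \<subseteq> cyl x r"
      using z by (intro exI[of _ ?U]) (auto simp: cyl_def PiE_UNIV_domain Pi_iff split: if_splits)
  qed
  have "\<exists>r. \<forall>y\<in>cyl x r. g y 0 = g x 0" for x
  proof -
    have "continuous_map ?T (discrete_topology UNIV) (\<lambda>x. g x 0)"
      using assms unfolding cellular_automaton_def config_topology_def
      by (simp add: continuous_map_componentwise_UNIV)
    then have "openin ?T {y \<in> topspace ?T. g y 0 \<in> {g x 0}}"
      by (rule openin_continuous_map_preimage) simp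
    then have "openin ?T {y. g y 0 = g x 0}"
      by (simp add: tops)
    then obtain U where U: "finite {i. U i \<noteq> (UNIV :: 'a set)}" "x \<in> Pi\<^sub>E UNIV U"
      "Pi\<^sub>E UNIV U \<subseteq> {y. g y 0 = g x 0}"
      unfolding config_topology_def openin_product_topology_alt
      by (auto dest!: bspec[where x = x])
    have "bdd_above (abs ` {i. U i \<noteq> UNIV})" using U(1) by simp
    then obtain r where r: "\<And>i. U i \<noteq> UNIV \<Longrightarrow> \<bar>i\<bar> \<le> r"
      unfolding bdd_above_def by auto
    have "cyl x (nat r) \<subseteq> Pi\<^sub>E UNIV U"
    proof
      fix y assume y: "y \<in> cyl x (nat r)"
      have "y i \<in> U i" for i
      proof (cases "U i = UNIV")
        case False
        then have "\<bar>i\<bar> \<le> int (nat r)" using r[of i] by linarith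
        then have "y i = x i" using y by (simp add: cyl_def)
        then show ?thesis using U(2) by (auto simp: PiE_UNIV_domain)
      qed simp
      then show "y \<in> Pi\<^sub>E UNIV U" by (simp add: PiE_UNIV_domain)
    qed
    then show ?thesis using U(3) by blast
  qed
  then obtain \<rho> where \<rho>: "\<And>x y. y \<in> cyl x (\<rho> x) \<Longrightarrow> g y 0 = g x 0" by metis
  have "(\<forall>C\<in>range (\<lambda>x. cyl x (\<rho> x)). openin ?T C) \<and> \<Union> (range (\<lambda>x. cyl x (\<rho> x))) = topspace ?T"
    using cyl_open by (auto simp: tops cyl_def)
  with comp obtain \<F> where F: "finite \<F>" "\<F> \<subseteq> range (\<lambda>x. cyl x (\<rho> x))" "\<Union>\<F> = UNIV"
    unfolding compact_space tops by (metis (no_types, lifting))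
  then obtain X where X: "finite X" "\<F> = (\<lambda>x. cyl x (\<rho> x)) ` X"
    by (meson finite_subset_image)
  define r where "r = Max (insert 0 (\<rho> ` X))"
  have "g x 0 = g y 0" if xy: "\<forall>j. \<bar>j\<bar> \<le> int r \<longrightarrow> x j = y j" for x y
  proof -
    have "x \<in> \<Union>\<F>" by (simp add: F(3))
    then obtain c where c: "c \<in> X" "x \<in> cyl c (\<rho> c)" using X by blast
    have "\<rho> c \<le> r" unfolding r_def using X(1) c(1) by simp
    then have "y \<in> cyl c (\<rho> c)"
      using c(2) xy by (auto simp: cyl_def)
    then show ?thesis using \<rho> c(2) by metis
  qed
  then show thesis by (intro that[of r]) (simp add: has_radius_def)
qed

text \<open>Such an automaton is determined by its local rule, a function from finitely many words
  to a finite alphabet.\<close>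

lemma finite_cellular_automata_of_radius:
  "finite {g :: ('a::finite) config \<Rightarrow> 'a config. cellular_automaton g \<and> has_radius r g}"
    (is "finite ?G")
proof -
  define W :: "'a list set" where "W = {w. length w = 2 * r + 1}"
  \<comment> \<open>The word is laid over the cells from -r to r; \<open>has_radius r\<close>
    shields the value from the arbitrary entries outside. \<open>restrict\<close> places the rule in
    a finite \<open>Pi\<^sub>E\<close>.\<close>
  define rule where "rule g = restrict (\<lambda>w. g (\<lambda>i. w ! nat (i + int r)) 0) W"
    for g :: "'a config \<Rightarrow> 'a config"
  have "finite W"
    using finite_lists_length_eq[of "UNIV :: 'a set" "2 * r + 1"] by (simp add: W_def)
  then have "finite (Pi\<^sub>E W (\<lambda>_. UNIV :: 'a set))"
    by (rule finite_PiE) simp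
  moreover have "rule ` ?G \<subseteq> Pi\<^sub>E W (\<lambda>_. UNIV)"
    by (auto simp: rule_def)
  moreover have "inj_on rule ?G"
  proof (rule inj_onI, intro ext)
    fix g h :: "'a config \<Rightarrow> 'a config" and x :: "'a config" and i
    assume g: "g \<in> ?G" and h: "h \<in> ?G" and eq: "rule g = rule h"
    define w :: "'a list" where "w = map (\<lambda>k. x (i + int k - int r)) [0..<2 * r + 1]"
    let ?u = "\<lambda>i. w ! nat (i + int r)"
    have u: "x (i + j) = ?u j" if "\<bar>j\<bar> \<le> int r" for j
    proof -
      have "nat (j + int r) < 2 * r + 1" "0 \<le> j + int r" using that by linarith+
      then show ?thesis using that by (simp add: w_def algebra_simps del: upt_Suc)
    qed
    have "g x i = g ?u 0" "h x i = h ?u 0"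
      using g h cellular_automaton_eq_local[where r = r and x = x and i = i and u = ?u, OF _ _ u]
      by simp_all
    moreover have "g ?u 0 = h ?u 0"
      using fun_cong[OF eq, of w] by (simp add: rule_def W_def w_def)
    ultimately show "g x i = h x i" by simp
  qed
  ultimately show ?thesis
    using finite_imageD finite_subset by blast
qed

lemma countable_cellular_automata:
  "countable {g :: ('a::finite) config \<Rightarrow> 'a config. cellular_automaton g}"
proof (rule countable_subset)
  show "{g :: 'a config \<Rightarrow> 'a config. cellular_automaton g}
    \<subseteq> (\<Union>r. {g. cellular_automaton g \<and> has_radius r g})"
    using cellular_automaton_has_radius by blast
  show "countable (\<Union>r. {g :: 'a config \<Rightarrow> 'a config. cellular_automaton g \<and> has_radius r g})"
    by (intro countable_UN countableI_type countable_finite finite_cellular_automata_of_radius)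
qed

text \<open>An output difference needs an input difference within distance r, so differences
  multiply by at most 2r+1, up to a border effect. The resulting \<open>d\<close> is uniform in both
  configurations.\<close>

lemma cellular_automaton_close:
  fixes g :: "('a::finite) config \<Rightarrow> 'a config"
  assumes "cellular_automaton g" "e > 0"
  obtains d where "d > 0" "\<And>x y. close d x y \<Longrightarrow> close e (g x) (g y)"
proof -
  obtain r where r: "has_radius r g"
    using cellular_automaton_has_radius[OF assms(1)] .
  define R where "R = real (2 * r + 1)"
  have R: "R > 0" by (simp add: R_def)
  have bound: "diff_freq (g x) (g y) n \<le> R * (diff_freq x y n + real (2 * r) / real (2 * n + 1))"
    for x y n
  proof -
    let ?D = "{i \<in> {- int n..int n}. x i \<noteq> y i}"
    \<comment> \<open>A neighbour \<open>i + j\<close> may leave the window, so the r cells beyond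
      each end are counted as if they all differed.\<close>
    let ?B = "?D \<union> {- int n - int r..<- int n} \<union> {int n<..int n + int r}"
    let ?E = "{i \<in> {- int n..int n}. g x i \<noteq> g y i}"
    have "?E \<subseteq> (\<Union>j\<in>{- int r..int r}. (\<lambda>b. b - j) ` ?B)"
    proof
      fix i assume i: "i \<in> ?E"
      have "\<exists>j. \<bar>j\<bar> \<le> int r \<and> x (i + j) \<noteq> y (i + j)"
      proof (rule ccontr)
        assume "\<not> ?thesis"
        then have "g x i = g (translate i y) 0"
          by (intro cellular_automaton_eq_local[OF assms(1) r]) (auto simp: translate_def add.commute)
        then show False
          using i assms(1) by (simp add: cellular_automaton_translate) (simp add: translate_def)
      qed
      then obtain j where j: "\<bar>j\<bar> \<le> int r" "x (i + j) \<noteq> y (i + j)" by blast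
      then have "i + j \<in> ?B" using i by auto
      then have "i \<in> (\<lambda>b. b - j) ` ?B" by (intro image_eqI[of _ _ "i + j"]) simp_all
      moreover have "j \<in> {- int r..int r}" using j(1) by auto
      ultimately show "i \<in> (\<Union>j\<in>{- int r..int r}. (\<lambda>b. b - j) ` ?B)" by blast
    qed
    then have "card ?E \<le> card (\<Union>j\<in>{- int r..int r}. (\<lambda>b. b - j) ` ?B)"
      by (intro card_mono finite_UN_I finite_imageI finite_UnI finite_window
          finite_atLeastAtMost_int finite_atLeastLessThan_int finite_greaterThanAtMost_int)
    also have "\<dots> \<le> (\<Sum>j\<in>{- int r..int r}. card ((\<lambda>b. b - j) ` ?B))"
      by (rule card_UN_le) simp
    also have "\<dots> \<le> (\<Sum>j\<in>{- int r..int r}. card ?B)"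
      by (intro sum_mono card_image_le finite_UnI finite_window
          finite_atLeastLessThan_int finite_greaterThanAtMost_int)
    also have "\<dots> = (2 * r + 1) * card ?B"
      by (simp add: nat_add_distrib nat_mult_distrib algebra_simps)
    also have "\<dots> \<le> (2 * r + 1) * (card ?D + 2 * r)"
    proof (rule mult_le_mono2)
      have "card ?B \<le> card ?D + card {- int n - int r..<- int n} + card {int n<..int n + int r}"
        by (meson add_le_mono1 card_Un_le order_trans)
      then show "card ?B \<le> card ?D + 2 * r" by simp
    qed
    finally have "card ?E \<le> (2 * r + 1) * (card ?D + 2 * r)" .
    then have "real (card ?E) \<le> real ((2 * r + 1) * (card ?D + 2 * r))"
      by (rule of_nat_mono)
    then have "real (card ?E) \<le> R * (real (card ?D) + real (2 * r))"
      unfolding R_def of_nat_mult[of "2 * r + 1"] of_nat_add[of "card ?D"] .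
    then have "real (card ?E) / real (2 * n + 1) \<le> R * (real (card ?D) + real (2 * r)) / real (2 * n + 1)"
      by (rule divide_right_mono) simp
    then show ?thesis
      unfolding diff_freq_def add_divide_distrib[symmetric] times_divide_eq_right .
  qed
  show thesis
  \<comment> \<open>Half of \<open>e / R\<close> covers the input differences, the other half the
    border term, which tends to 0.\<close>
  proof (rule that[of "e / (2 * R)"])
    fix x y :: "'a config" assume "close (e / (2 * R)) x y"
    moreover have "(\<lambda>n. real (2 * r) / real (2 * n + 1)) \<longlonglongrightarrow> 0" by real_asymp
    then have "eventually (\<lambda>n. real (2 * r) / real (2 * n + 1) < e / (2 * R)) sequentially"
      by (rule order_tendstoD) (use R assms(2) in simp)
    ultimately show "close e (g x) (g y)"
      unfolding close_def
    proof eventually_elim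
      case (elim n)
      then have "R * (diff_freq x y n + real (2 * r) / real (2 * n + 1)) < R * (e / (2 * R) + e / (2 * R))"
        using R by (intro mult_strict_left_mono) auto
      also have "\<dots> = e" using R by (simp add: field_simps)
      finally show ?case using bound[of x y n] by linarith
    qed
  qed (use R assms(2) in simp)
qed

section \<open>A path of configurations\<close>

text \<open>The relative position, in \<open>[0, 1)\<close>, of \<open>m\<close> in its dyadic block; the shift by 1 in
  \<open>nat \<bar>i\<bar> + 1\<close> below avoids the junk value at \<open>m = 0\<close>.\<close>
definition phase :: "nat \<Rightarrow> real" where
  "phase m = real m / 2 ^ floor_log m - 1"

text \<open>For \<open>t\<close> in [0, 1], \<open>x\<close> fills the initial fraction
  \<open>t\<close> of every dyadic block on both sides of the origin. Spreading the change over all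
  blocks makes it gradual in density.\<close>

definition blend :: "'a config \<Rightarrow> 'a config \<Rightarrow> real \<Rightarrow> 'a config" where
  "blend x y t = (\<lambda>i. if phase (nat \<bar>i\<bar> + 1) < t then x i else y i)"

lemma phase_bounds: "m > 0 \<Longrightarrow> 0 \<le> phase m" "phase m < 1"
proof -
  show "0 \<le> phase m" if "m > 0"
  proof -
    have "real (2 ^ floor_log m) \<le> real m"
      using floor_log_exp2_le[OF that] by (rule of_nat_mono)
    then show ?thesis by (simp add: phase_def field_simps)
  qed
  have "real m < real (2 * 2 ^ floor_log m)"
    using floor_log_exp2_gt[of m] by (rule less_imp_of_nat_less)
  then show "phase m < 1" by (simp add: phase_def field_simps)
qed

lemma blend_0: "blend x y 0 = y" and blend_1: "blend x y 1 = x"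
  using phase_bounds(1)[THEN leD] phase_bounds(2) by (simp_all add: blend_def)

lemma card_nat_interval_le:
  assumes "0 \<le> a" "a \<le> b"
  shows "finite {m::nat. a \<le> real m \<and> real m < b}"
    and "real (card {m::nat. a \<le> real m \<and> real m < b}) \<le> b - a + 1"
proof -
  have eq: "{m::nat. a \<le> real m \<and> real m < b} = {nat \<lceil>a\<rceil>..<nat \<lceil>b\<rceil>}"
    using assms by (auto simp: less_ceiling_iff nat_ceiling_le_eq zless_nat_eq_int_zless)
  then show "finite {m::nat. a \<le> real m \<and> real m < b}" by simp
  have "\<lceil>a\<rceil> \<le> \<lceil>b\<rceil>" using assms by (intro ceiling_mono)
  then have "real (card {nat \<lceil>a\<rceil>..<nat \<lceil>b\<rceil>}) = \<lceil>b\<rceil> - \<lceil>a\<rceil>"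
    using assms by (simp add: of_nat_diff[OF nat_mono])
  also have "\<dots> \<le> b - a + 1" by linarith
  finally show "real (card {m::nat. a \<le> real m \<and> real m < b}) \<le> b - a + 1" by (simp add: eq)
qed

text \<open>In each dyadic block the phase condition confines \<open>m\<close> to an interval of
  relative length \<open>t - s\<close>; each of the \<open>K\<close> blocks costs at most 1 for
  rounding.\<close>

lemma card_phase_le:
  assumes "0 \<le> s" "s \<le> t"
  shows "real (card {m. 0 < m \<and> m < 2 ^ K \<and> s \<le> phase m \<and> phase m < t}) \<le> (t - s) * 2 ^ K + real K"
proof (induction K)
  case 0
  have "{m. 0 < m \<and> m < (2::nat) ^ 0 \<and> s \<le> phase m \<and> phase m < t} = {}" by auto
  then show ?case using assms by (simp only: card.empty) simp
next
  case (Suc K)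
  let ?S = "\<lambda>K. {m. 0 < m \<and> m < 2 ^ K \<and> s \<le> phase m \<and> phase m < t}"
  let ?I = "{m::nat. (1 + s) * 2 ^ K \<le> real m \<and> real m < (1 + t) * 2 ^ K}"
  have I: "finite ?I" "real (card ?I) \<le> (1 + t) * 2 ^ K - (1 + s) * 2 ^ K + 1"
    using card_nat_interval_le[of "(1 + s) * 2 ^ K" "(1 + t) * 2 ^ K"] assms by auto
  have fin: "finite (?S K)" by (rule finite_subset[of _ "{..<2 ^ K}"]) auto
  have "?S (Suc K) \<subseteq> ?S K \<union> ?I"
  proof
    fix m assume m: "m \<in> ?S (Suc K)"
    show "m \<in> ?S K \<union> ?I"
    proof (cases "m < 2 ^ K")
      case False
      then have "floor_log m = K" using m by (intro floor_log_eqI) auto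
      then have "m \<in> ?I" using m by (auto simp: phase_def field_simps)
      then show ?thesis by blast
    qed (use m in auto)
  qed
  then have "card (?S (Suc K)) \<le> card (?S K \<union> ?I)"
    using fin I(1) by (intro card_mono) auto
  also have "\<dots> \<le> card (?S K) + card ?I" by (rule card_Un_le)
  finally have "real (card (?S (Suc K))) \<le> real (card (?S K)) + real (card ?I)" by linarith
  also have "\<dots> \<le> (t - s) * 2 ^ K + real K + ((1 + t) * 2 ^ K - (1 + s) * 2 ^ K + 1)"
    using Suc I(2) by linarith
  also have "\<dots> = (t - s) * 2 ^ Suc K + real (Suc K)" by (simp add: algebra_simps)
  finally show ?case .
qed

text \<open>The blends can differ only where the phase lies in [s, t). In the bound, the 4 comes
  from the two signs of \<open>i\<close> and from enlarging the window to a power of two; the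
  logarithm collects the rounding errors of the blocks.\<close>

lemma blend_close_aux:
  assumes "0 \<le> s" "s \<le> t" "4 * (t - s) < e"
  shows "close e (blend x y s) (blend x y t)"
proof -
  have bound: "diff_freq (blend x y s) (blend x y t) n
      \<le> 4 * (t - s) * (real (n + 1) / real (2 * n + 1)) + 2 * (log 2 (real (n + 1)) + 1) / real (2 * n + 1)" for n
  proof -
    let ?D = "{i \<in> {- int n..int n}. blend x y s i \<noteq> blend x y t i}"
    \<comment> \<open>\<open>2 ^ K\<close> is the least power of two above \<open>n + 1\<close>,
      hence at most \<open>2 * (n + 1)\<close>; cell \<open>i\<close> corresponds to
      \<open>m = \<bar>i\<bar> + 1\<close>.\<close>
    define K where "K = Suc (floor_log (n + 1))"
    let ?S = "{m. 0 < m \<and> m < 2 ^ K \<and> s \<le> phase m \<and> phase m < t}"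
    have fin: "finite ?S" by (rule finite_subset[of _ "{..<2 ^ K}"]) auto
    have K1: "n + 1 < 2 ^ K" unfolding K_def using floor_log_exp2_gt[of "n + 1"] by simp
    have "2 ^ floor_log (n + 1) \<le> n + 1" by (rule floor_log_exp2_le) simp
    then have "2 ^ K \<le> 2 * (n + 1)" by (simp add: K_def)
    then have K2: "(2::real) ^ K \<le> 2 * real (n + 1)"
      by (metis of_nat_le_iff of_nat_mult of_nat_numeral of_nat_power)
    have K3: "real K \<le> log 2 (real (n + 1)) + 1"
      by (simp add: K_def floor_log_altdef)
    have "?D \<subseteq> (\<lambda>m. int m - 1) ` ?S \<union> (\<lambda>m. 1 - int m) ` ?S"
    proof
      fix i assume i: "i \<in> ?D"
      have "nat \<bar>i\<bar> + 1 \<in> ?S"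
        using i K1 assms(2) by (auto simp: blend_def split: if_splits)
      then have "int (nat \<bar>i\<bar> + 1) - 1 \<in> (\<lambda>m. int m - 1) ` ?S"
        "1 - int (nat \<bar>i\<bar> + 1) \<in> (\<lambda>m. 1 - int m) ` ?S"
        by (rule imageI)+
      then show "i \<in> (\<lambda>m. int m - 1) ` ?S \<union> (\<lambda>m. 1 - int m) ` ?S"
        by (cases "i \<ge> 0") simp_all
    qed
    then have "card ?D \<le> card ((\<lambda>m. int m - 1) ` ?S \<union> (\<lambda>m. 1 - int m) ` ?S)"
      using fin by (intro card_mono) auto
    also have "\<dots> \<le> card ((\<lambda>m. int m - 1) ` ?S) + card ((\<lambda>m. 1 - int m) ` ?S)"
      by (rule card_Un_le)
    also have "\<dots> \<le> card ?S + card ?S"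
      using fin by (intro add_mono card_image_le)
    finally have "real (card ?D) \<le> 2 * real (card ?S)" by linarith
    also have "\<dots> \<le> 2 * ((t - s) * 2 ^ K + real K)"
      using card_phase_le[OF assms(1,2), of K] by simp
    also have "\<dots> \<le> 2 * ((t - s) * (2 * real (n + 1)) + (log 2 (real (n + 1)) + 1))"
      using K2 K3 assms(2) by (intro mult_left_mono add_mono) auto
    also have "\<dots> = 4 * (t - s) * real (n + 1) + 2 * (log 2 (real (n + 1)) + 1)"
      by (simp add: algebra_simps)
    finally have "real (card ?D) / real (2 * n + 1)
        \<le> (4 * (t - s) * real (n + 1) + 2 * (log 2 (real (n + 1)) + 1)) / real (2 * n + 1)"
      by (rule divide_right_mono) simp
    then show ?thesis
      unfolding diff_freq_def add_divide_distrib[of "4 * (t - s) * _"] times_divide_eq_right .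
  qed
  have "(\<lambda>n. real (n + 1) / real (2 * n + 1)) \<longlonglongrightarrow> 1 / 2"
    and "(\<lambda>n. 2 * (log 2 (real (n + 1)) + 1) / real (2 * n + 1)) \<longlonglongrightarrow> 0"
    by real_asymp+
  then have "(\<lambda>n. 4 * (t - s) * (real (n + 1) / real (2 * n + 1))
      + 2 * (log 2 (real (n + 1)) + 1) / real (2 * n + 1)) \<longlonglongrightarrow> 4 * (t - s) * (1 / 2) + 0"
    by (intro tendsto_add tendsto_mult tendsto_const)
  moreover have "4 * (t - s) * (1 / 2) + 0 < e" using assms by auto
  ultimately have "eventually (\<lambda>n. 4 * (t - s) * (real (n + 1) / real (2 * n + 1))
      + 2 * (log 2 (real (n + 1)) + 1) / real (2 * n + 1) < e) sequentially"
    by (rule order_tendstoD)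
  then show ?thesis
    unfolding close_def by eventually_elim (use bound in \<open>rule le_less_trans\<close>)
qed

lemma blend_close:
  assumes "0 \<le> s" "0 \<le> t" "4 * \<bar>t - s\<bar> < e"
  shows "close e (blend x y s) (blend x y t)"
  using blend_close_aux[of s t e x y] blend_close_aux[of t s e x y] close_sym assms
  by (cases "s \<le> t") auto

section \<open>A generic configuration\<close>

text \<open>On the dyadic block \<open>2 ^ k \<le> \<bar>i\<bar> + 1 < 2 ^ (k + 1)\<close> it repeats the \<open>k\<close>-th word of a list
  in which every word occurs infinitely often.\<close>
definition block_word :: "nat \<Rightarrow> ('a::countable) list" where
  "block_word k = from_nat (fst (prod_decode k))"

definition generic :: "('a::countable) config" where
  "generic i = (let w = block_word (floor_log (nat \<bar>i\<bar> + 1)) in w ! nat (i mod int (length w)))"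

text \<open>Pairing the code of \<open>w\<close> with \<open>n\<close> gives an index of at least
  \<open>n\<close>; the second component is there to provide these repetitions.\<close>

lemma block_word_infinitely_often: "\<exists>k\<ge>n. block_word k = w"
proof (intro exI conjI)
  show "n \<le> prod_encode (to_nat w, n)" by (rule le_prod_encode_2)
  show "block_word (prod_encode (to_nat w, n)) = w" by (simp add: block_word_def)
qed

text \<open>The part of block \<open>k\<close> with phase below \<open>t\<close> shows
  \<open>generic\<close>: about \<open>t * 2 ^ k\<close> cells tiled by a word of length
  \<open>L\<close>. At most three copies are lost to rounding and edges, and by \<open>large\<close>
  at least half remain.\<close>

lemma many_local_occurrences:
  fixes y u :: "('a::countable) config"
  assumes "0 < t" "t \<le> 1" and L: "L = 2 * r + 1" and large: "t * 2 ^ k \<ge> 6 * real L"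
    and word: "block_word k = map (\<lambda>j. u (int j - int r)) [0..<L]"
  defines "z \<equiv> blend generic y t"
  shows "t * 2 ^ k / (2 * real L)
    \<le> real (card {i \<in> {- int (2 ^ Suc k)..int (2 ^ Suc k)}. \<forall>j. \<bar>j\<bar> \<le> int r \<longrightarrow> z (i + j) = u j})"
proof -
  let ?O = "{i \<in> {- int (2 ^ Suc k)..int (2 ^ Suc k)}. \<forall>j. \<bar>j\<bar> \<le> int r \<longrightarrow> z (i + j) = u j}"
  \<comment> \<open>Copy \<open>q\<close> starts at cell \<open>L * q\<close> and is centred at
    \<open>L * q + r\<close>. Copy \<open>Q\<close> starts at most \<open>L\<close> cells after
    \<open>2 ^ k\<close>; the 2 taken off in \<open>M\<close> pays for this delay and leaves room
    before \<open>(1 + t) * 2 ^ k\<close>.\<close>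
  define Q where "Q = (2::nat) ^ k div L + 1"
  define M where "M = nat \<lfloor>t * 2 ^ k / real L\<rfloor> - 2"
  have Lpos: "L > 0" using L by simp
  have big: "6 \<le> t * 2 ^ k / real L" using large Lpos by (simp add: field_simps)
  have M1: "real M \<le> t * 2 ^ k / real L - 2" and M2: "t * 2 ^ k / real L - 3 \<le> real M"
    unfolding M_def using big by linarith+
  have LQ1: "2 ^ k \<le> L * Q" and LQ2: "L * Q \<le> 2 ^ k + L"
  proof -
    have "2 ^ k mod L + L * (2 ^ k div L) = 2 ^ k" by (rule mod_mult_div_eq)
    moreover have "2 ^ k mod L < L" using Lpos by simp
    moreover have "L * Q = L * (2 ^ k div L) + L" by (simp add: Q_def)
    ultimately show "2 ^ k \<le> L * Q" "L * Q \<le> 2 ^ k + L" by linarith+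
  qed
  have sub: "(\<lambda>q. int (L * q + r)) ` {Q..<Q + M} \<subseteq> ?O"
  proof
    fix i assume "i \<in> (\<lambda>q. int (L * q + r)) ` {Q..<Q + M}"
    then obtain q where q: "Q \<le> q" "q < Q + M" and i: "i = int (L * q + r)" by auto
    have low: "2 ^ k \<le> L * q" using LQ1 q(1) by (meson le_trans mult_le_mono2)
    have "L * (q + 1) \<le> L * (Q + M)" using q(2) by (intro mult_le_mono2) simp
    then have "real (L * q + L) \<le> real (L * Q + L * M)"
      by (metis add_mult_distrib2 mult.right_neutral of_nat_mono)
    also have "\<dots> \<le> (2 ^ k + real L) + real L * (t * 2 ^ k / real L - 2)"
    proof -
      have "real (L * Q) \<le> real (2 ^ k + L)" using LQ2 by (rule of_nat_mono)
      moreover have "real L * real M \<le> real L * (t * 2 ^ k / real L - 2)"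
        using M1 by (intro mult_left_mono) auto
      ultimately show ?thesis by simp
    qed
    also have "\<dots> < (1 + t) * 2 ^ k" using Lpos by (simp add: algebra_simps)
    finally have high: "real (L * q + L) < (1 + t) * 2 ^ k" .
    also have "\<dots> \<le> 2 * 2 ^ k" using assms(2) by simp
    finally have "real (L * q + L) < real (2 * 2 ^ k)" by simp
    then have high2: "L * q + L < 2 * 2 ^ k" by linarith
    have "z (i + j) = u j" if j: "\<bar>j\<bar> \<le> int r" for j
    proof -
      define m where "m = nat (int r + j)"
      have m: "m < L" "j = int m - int r" "i + j = int (L * q + m)"
        using j by (auto simp: m_def L i)
      have fl: "floor_log (L * q + m + 1) = k"
        using low high2 m(1) by (intro floor_log_eqI) auto
      have "real (L * q + m + 1) \<le> real (L * q + L)" using m(1) by linarith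
      then have "real (L * q + m + 1) < (1 + t) * 2 ^ k" using high by linarith
      then have "phase (L * q + m + 1) < t"
        unfolding phase_def fl by (simp add: field_simps)
      then have "z (i + j) = generic (int (L * q + m))"
        unfolding z_def blend_def m(3) by (simp only: abs_of_nat nat_int if_True)
      also have "\<dots> = block_word k ! nat (int (L * q + m) mod int L)"
        using fl by (simp add: generic_def Let_def word add_ac nat_add_distrib nat_mult_distrib del: upt_Suc)
      also have "nat (int (L * q + m) mod int L) = m"
        using m(1) by (metis mod_less mod_mult_self4 nat_int of_nat_mod add.commute)
      also have "block_word k ! m = u j"
        using m by (simp add: word)
      finally show ?thesis .
    qed
    moreover have "i \<in> {- int (2 ^ Suc k)..int (2 ^ Suc k)}"
    proof -
      have "L * q + r \<le> 2 ^ Suc k" using high2 L by simp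
      then have "i \<le> int (2 ^ Suc k)" unfolding i by (simp only: of_nat_le_iff)
      moreover have "- int (2 ^ Suc k) \<le> 0" "0 \<le> i" using i by simp_all
      ultimately show ?thesis by simp
    qed
    ultimately show "i \<in> ?O" by blast
  qed
  have "inj_on (\<lambda>q. int (L * q + r)) {Q..<Q + M}"
    using Lpos by (auto intro!: inj_onI)
  then have "M = card ((\<lambda>q. int (L * q + r)) ` {Q..<Q + M})" by (simp add: card_image)
  also have "\<dots> \<le> card ?O" by (rule card_mono[OF finite_window sub])
  finally have "real M \<le> real (card ?O)" by simp
  moreover have "t * 2 ^ k / (2 * real L) \<le> real M"
  proof -
    \<comment> \<open>The constant 6 in \<open>large\<close> enters here: \<open>v - 3\<close> is at
      least \<open>v / 2\<close> once \<open>v\<close> is at least 6.\<close>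
    define v where "v = t * 2 ^ k / real L"
    have "t * 2 ^ k / (2 * real L) = v / 2" by (simp add: v_def)
    then show ?thesis using M2 big unfolding v_def[symmetric] by linarith
  qed
  ultimately show ?thesis by linarith
qed

text \<open>A pattern on which the local rules differ occurs in the blend with positive upper
  density whatever \<open>y\<close> is, since \<open>generic\<close> keeps a fraction
  \<open>t\<close> of each block; every occurrence makes the images differ.\<close>

lemma cellular_automaton_unique_on_blend:
  fixes g h :: "('a::finite) config \<Rightarrow> 'a config"
  assumes g: "cellular_automaton g" and h: "cellular_automaton h"
    and t: "0 < t" "t \<le> 1"
    and eqv: "\<And>e. e > 0 \<Longrightarrow> close e (g (blend generic y t)) (h (blend generic y t))"
  shows "g = h"
proof (rule ccontr)
  assume "g \<noteq> h"
  then obtain x i where "g x i \<noteq> h x i" by (meson ext)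
  define u where "u = translate i x"
  have u: "g u 0 \<noteq> h u 0"
    unfolding u_def using \<open>g x i \<noteq> h x i\<close> g h
    by (simp add: cellular_automaton_translate) (simp add: translate_def)
  obtain r1 r2 where "has_radius r1 g" "has_radius r2 h"
    using cellular_automaton_has_radius g h by metis
  then obtain r where rg: "has_radius r g" and rh: "has_radius r h"
    using has_radius_mono by (metis max.cobounded1 max.cobounded2)
  define L where "L = 2 * r + 1"
  define z where "z = blend generic y t"
  \<comment> \<open>The \<open>t * 2 ^ k / (2 * real L)\<close> guaranteed occurrences, divided by
    \<open>8 * 2 ^ k\<close>, a bound on the window size \<open>2 * n + 1\<close> for
    \<open>n = 2 ^ Suc k\<close>.\<close>
  define c where "c = t / (16 * real L)"
  have "c > 0" using t by (simp add: c_def L_def)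
  then have "close c (g z) (h z)" unfolding z_def by (rule eqv)
  then obtain N where N: "\<And>n. n \<ge> N \<Longrightarrow> diff_freq (g z) (h z) n < c"
    unfolding close_def eventually_sequentially by blast
  have "filterlim (\<lambda>k::nat. t * 2 ^ k) at_top sequentially"
    using t(1) by real_asymp
  then obtain K where K: "\<And>k. k \<ge> K \<Longrightarrow> t * 2 ^ k \<ge> 6 * real L"
    unfolding filterlim_at_top eventually_sequentially by blast
  obtain k where k: "k \<ge> max N K" "block_word k = map (\<lambda>j. u (int j - int r)) [0..<L]"
    using block_word_infinitely_often by blast
  define n where "n = (2::nat) ^ Suc k"
  have "n \<ge> N"
    using k(1) less_exp[of "Suc k"] unfolding n_def by linarith
  have "t * 2 ^ k / (2 * real L)
      \<le> real (card {i \<in> {- int n..int n}. \<forall>j. \<bar>j\<bar> \<le> int r \<longrightarrow> z (i + j) = u j})"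
    unfolding n_def z_def using t k K[of k] by (intro many_local_occurrences) (auto simp: L_def)
  also have "\<dots> \<le> real (card {i \<in> {- int n..int n}. g z i \<noteq> h z i})"
  proof (intro of_nat_mono card_mono finite_window Collect_mono impI)
    fix i assume i: "i \<in> {- int n..int n} \<and> (\<forall>j. \<bar>j\<bar> \<le> int r \<longrightarrow> z (i + j) = u j)"
    then have "g z i = g u 0" "h z i = h u 0"
      using cellular_automaton_eq_local[OF g rg] cellular_automaton_eq_local[OF h rh] by blast+
    with u i show "i \<in> {- int n..int n} \<and> g z i \<noteq> h z i" by simp
  qed
  finally have "t * 2 ^ k / (2 * real L) / real (2 * n + 1) \<le> diff_freq (g z) (h z) n"
    unfolding diff_freq_def by (rule divide_right_mono) simp
  moreover have "c \<le> t * 2 ^ k / (2 * real L) / real (2 * n + 1)"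
  proof -
    have "real (2 * n + 1) = 4 * 2 ^ k + 1" by (simp add: n_def)
    then have "real (2 * n + 1) \<le> 8 * 2 ^ k" using one_le_power[of "2 :: real" k] by linarith
    then have "t * 2 ^ k / (2 * real L) / (8 * 2 ^ k) \<le> t * 2 ^ k / (2 * real L) / real (2 * n + 1)"
      using t by (intro divide_left_mono) auto
    then show ?thesis by (simp add: c_def)
  qed
  ultimately show False using N[OF \<open>n \<ge> N\<close>] by linarith
qed

section \<open>A single automaton along the path\<close>

text \<open>At a limit time \<open>t\<close>, pass through a nearby agreement time \<open>s\<close>,
  at cost \<open>e/3\<close> for each of \<open>f\<close>, the agreement and \<open>g\<close>. Since
  \<open>f\<close> is continuous only pointwise, \<open>d1\<close> is taken at the limit point;
  \<open>d2\<close> is uniform.\<close>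

lemma closed_agreement_times:
  fixes f g :: "('a::finite) config \<Rightarrow> 'a config"
  assumes f: "besicovitch_continuous f" and g: "cellular_automaton g" and "0 \<le> a"
  shows "closed {t \<in> {a..b}. f (blend x y t) \<sim>\<^sub>B g (blend x y t)}" (is "closed ?T")
proof -
  let ?z = "blend x y"
  have "t \<in> ?T" if t: "t \<in> closure ?T" for t
  proof -
    have "t \<in> {a..b}"
      by (rule subsetD[OF closure_minimal t]) auto
    moreover have "close e (f (?z t)) (g (?z t))" if "e > 0" for e
    proof -
      obtain d1 where d1: "d1 > 0" "\<And>w. close d1 (?z t) w \<Longrightarrow> close (e/3) (f (?z t)) (f w)"
        using besicovitch_continuous_close[OF f, of "e/3" "?z t"] \<open>e > 0\<close>
        by (metis divide_pos_pos zero_less_numeral)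
      obtain d2 where d2: "d2 > 0" "\<And>v w. close d2 v w \<Longrightarrow> close (e/3) (g v) (g w)"
        using cellular_automaton_close[OF g, of "e/3"] \<open>e > 0\<close>
        by (metis divide_pos_pos zero_less_numeral)
      \<comment> \<open>The 4 is the factor lost in \<open>blend_close\<close>.\<close>
      have "min d1 d2 / 4 > 0" using d1(1) d2(1) by simp
      then obtain s where s: "s \<in> ?T" "\<bar>s - t\<bar> < min d1 d2 / 4"
        using t unfolding closure_approachable dist_real_def by blast
      have "close d1 (?z t) (?z s)" "close d2 (?z s) (?z t)"
        using s \<open>t \<in> {a..b}\<close> \<open>0 \<le> a\<close> by (auto intro!: blend_close simp: abs_minus_commute)
      then have "close (e/3) (f (?z t)) (f (?z s))" "close (e/3) (g (?z s)) (g (?z t))"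
        using d1(2) d2(2) by auto
      moreover have "close (e/3) (f (?z s)) (g (?z s))"
        using s(1) \<open>e > 0\<close> by (simp add: equiv_iff_close)
      ultimately have "close (e/3 + e/3 + e/3) (f (?z t)) (g (?z t))"
        using close_triangle by blast
      then show ?thesis by simp
    qed
    ultimately show ?thesis by (simp add: equiv_iff_close)
  qed
  then have "closure ?T \<subseteq> ?T" by (rule subsetI)
  then show ?thesis by (simp only: closure_subset_eq)
qed

theorem theorem8:
  fixes f :: "('a::finite) config \<Rightarrow> 'a config"
  assumes "CA_like f"
  shows "\<exists>g. cellular_automaton g \<and> (\<forall>x. f x \<sim>\<^sub>B g x)"
proof -
  have f: "besicovitch_continuous f"
    and ex: "\<And>x. \<exists>g. cellular_automaton g \<and> f x \<sim>\<^sub>B g x"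
    using assms by (auto simp: CA_like_def)
  obtain g where g: "cellular_automaton g" "f generic \<sim>\<^sub>B g generic"
    using ex by blast
  have "f y \<sim>\<^sub>B g y" for y
  proof -
    let ?z = "blend generic y"
    define T where "T a h = {t \<in> {a..1}. f (?z t) \<sim>\<^sub>B h (?z t)}" for a :: real and h
    \<comment> \<open>At time 0 the path is at \<open>y\<close>, where distinct automata may agree;
      hence \<open>0 < a\<close>.\<close>
    have unique: "h = h'" if "cellular_automaton h" "cellular_automaton h'" "0 < a"
      "t \<in> T a h" "t \<in> T a h'" for h h' a t
    proof (rule cellular_automaton_unique_on_blend[OF that(1,2)])
      show "0 < t" "t \<le> 1" using that by (auto simp: T_def)
      fix e :: real assume "e > 0"
      then have "close (e/2) (h (?z t)) (f (?z t))" "close (e/2) (f (?z t)) (h' (?z t))"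
        using that by (auto simp: T_def equiv_iff_close close_sym)
      then show "close e (h (?z t)) (h' (?z t))"
        using close_triangle by fastforce
    qed
    have pos: "f (?z t) \<sim>\<^sub>B g (?z t)" if t: "0 < t" "t \<le> 1" for t
    proof -
      \<comment> \<open>Sierpinski's lemma asks for nonempty members. Taking the image merges
        automata with equal time sets.\<close>
      define \<U> where "\<U> = T t ` {h. cellular_automaton h} - {{}}"
      have "\<U> = {{t..1}}"
      proof (rule real_Sierpinski_lemma)
        show "countable \<U>"
          unfolding \<U>_def using countable_cellular_automata by (intro countable_Diff countable_image)
        show "pairwise disjnt \<U>"
          using unique[OF _ _ t(1)] by (auto simp: pairwise_def \<U>_def disjnt_iff)
        show "closed C \<and> C \<noteq> {}" if "C \<in> \<U>" for C
          using that t closed_agreement_times[OF f] by (auto simp: \<U>_def T_def)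
        show "\<Union>\<U> = {t..1}"
        proof
          show "{t..1} \<subseteq> \<Union>\<U>"
          proof
            fix s assume s: "s \<in> {t..1}"
            obtain h where h: "cellular_automaton h" "f (?z s) \<sim>\<^sub>B h (?z s)" using ex by blast
            with s have "s \<in> T t h" by (simp add: T_def)
            with h(1) show "s \<in> \<Union>\<U>" by (auto simp: \<U>_def)
          qed
        qed (auto simp: \<U>_def T_def)
      qed (use t in simp)
      \<comment> \<open>At time 1 the path is at \<open>generic\<close>, where \<open>g\<close> was
        chosen; so the time set of \<open>g\<close> is nonempty and is the only member of
        \<open>\<U>\<close>.\<close>
      moreover have "1 \<in> T t g" using g(2) t by (simp add: T_def blend_1)
      then have "T t g \<in> \<U>" using g(1) by (auto simp: \<U>_def)
      ultimately have "T t g = {t..1}" by blast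
      then have "t \<in> T t g" using t by simp
      then show ?thesis by (simp add: T_def)
    qed
    \<comment> \<open>Time 0, where the path is at \<open>y\<close>, is reached only as a limit of
      positive times.\<close>
    have "{0<..1} \<subseteq> T 0 g" using pos by (auto simp: T_def)
    moreover have "closed (T 0 g)"
      unfolding T_def using closed_agreement_times[OF f g(1)] by simp
    ultimately have "closure {0<..1} \<subseteq> T 0 g" by (rule closure_minimal)
    then have "{0..1} \<subseteq> T 0 g" by simp
    then have "0 \<in> T 0 g" by (rule subsetD) simp
    then show ?thesis by (simp add: T_def blend_0)
  qed
  with g(1) show ?thesis by blast
qed

end
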